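(* For any NPS-CDE system, the output $\beta$ of the deterministic algorithm described in the context satisfies $\beta\le\alpha^*$, where $\alpha^*$ is the minimum sum-rate of the system.
   Context: A cooperative data exchange (CDE) system consists of a finite packet set $\mathcal{P}=\{\mathbf{p}_1,\dots,\mathbf{p}_L\}$ of $L$ elements, a client set $\mathcal{K}=\{1,\dots,K\}$ with $K\ge 2$, and has-sets $\mathcal{H}_j\subseteq\mathcal{P}$ for $j\in\mathcal{K}$ satisfying $\bigcup_{j\in\mathcal{K}}\mathcal{H}_j=\mathcal{P}$. Write $\mathcal{H}_j^c=\mathcal{P}\setminus\mathcal{H}_j$. For every proper subset $\mathcal{X}\subsetneq\mathcal{K}$ (possibly empty) define $$g(\mathcal{X})=\Bigl|\bigcap_{j\in\mathcal{K}\setminus\mathcal{X}}\mathcal{H}_j^c\Bigr| .$$ For $\mathbf{r}=(r_1,\dots,r_K)$ and $\mathcal{X}\subseteq\mathcal{K}$ write $\mathbf{r}(\mathcal{X})=\sum_{j\in\mathcal{X}}r_j$. In an NPS-CDE system (no packet splitting), for an integer $\alpha\ge0$ let $$\mathcal{R}_\alpha=\{\mathbf{r}\in\mathbb{N}_0^K : \mathbf{r}(\mathcal{X})\ge g(\mathcal{X})\ \text{for all } \mathcal{X}\subsetneq\mathcal{K},\ \mathbf{r}(\mathcal{K})=\alpha\},$$ where $\mathbb{N}_0$ denotes the nonnegative integers. The minimum sum-rate $\alpha^*$ is the smallest nonnegative integer $\alpha$ such that $\mathcal{R}_\alpha$ is nonempty. Deterministic algorithm (Algorithm 1): 1. Initialize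 $\beta=\Bigl\lceil\sum_{j\in\mathcal{K}}\frac{g(\mathcal{K}\setminus\{j\})}{K-1}\Bigr\rceil$. 2. For $k=1,\dots,K$: set $\mathcal{W}_1=\{k\}$; then for $m=2,\dots,K-1$ (no iterations if $K=2$) do, in order: (i) choose $u_m^*\in\arg\max\bigl\{g(\mathcal{K}\setminus(\mathcal{W}_{m-1}\cup\{u\}))-g(\mathcal{K}\setminus\{u\}) : u\in\mathcal{K}\setminus\mathcal{W}_{m-1}\bigr\}$ (any maximizer); (ii) set $\mathcal{W}_m=\mathcal{W}_{m-1}\cup\{u_m^*\}$; (iii) replace $\beta$ by $\max\Bigl\{\beta,\ \Bigl\lceil\frac{g(\mathcal{K}\setminus\mathcal{W}_m)+\sum_{j\in\mathcal{K}\setminus\mathcal{W}_m}g(\mathcal{K}\setminus\{j\})}{|\mathcal{K}\setminus\mathcal{W}_m|}\Bigr\rceil\Bigr\}$. 3. Output $\beta$. *)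

theory Defs
  imports Complex_Main "HOL-Library.FuncSet"
begin

abbreviation clients :: "nat \<Rightarrow> nat set" where
  "clients K \<equiv> {1..K}"

definition cde_system :: "'p set \<Rightarrow> nat \<Rightarrow> (nat \<Rightarrow> 'p set) \<Rightarrow> bool" where
  "cde_system P K H \<longleftrightarrow>
     finite P \<and> 2 \<le> K \<and> (\<forall>j\<in>clients K. H j \<subseteq> P) \<and> (\<Union>j\<in>clients K. H j) = P"

text \<open>Only meaningful for a proper subset \<open>X\<close> of the clients: otherwise the intersection
  has an empty index set. It is never used outside that range below.\<close>

definition g :: "'p set \<Rightarrow> nat \<Rightarrow> (nat \<Rightarrow> 'p set) \<Rightarrow> nat set \<Rightarrow> nat" where
  "g P K H X = card (\<Inter>j\<in>clients K - X. P - H j)"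

text \<open>Rate vectors are extensional functions on the clients, so that a vector is determined
  by its \<open>K\<close> components.\<close>

definition rate_region :: "'p set \<Rightarrow> nat \<Rightarrow> (nat \<Rightarrow> 'p set) \<Rightarrow> nat \<Rightarrow> (nat \<Rightarrow> nat) set" where
  "rate_region P K H \<alpha> =
     {r \<in> clients K \<rightarrow>\<^sub>E UNIV. (\<forall>X. X \<subset> clients K \<longrightarrow> g P K H X \<le> sum r X) \<and>
        sum r (clients K) = \<alpha>}"

definition min_sum_rate :: "'p set \<Rightarrow> nat \<Rightarrow> (nat \<Rightarrow> 'p set) \<Rightarrow> nat" where
  "min_sum_rate P K H = (LEAST \<alpha>. rate_region P K H \<alpha> \<noteq> {})"

definition initial_bound :: "'p set \<Rightarrow> nat \<Rightarrow> (nat \<Rightarrow> 'p set) \<Rightarrow> int" where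
  "initial_bound P K H =
     \<lceil>\<Sum>j\<in>clients K. real (g P K H (clients K - {j})) / (real K - 1)\<rceil>"

text \<open>The gain is integer valued because the difference is typically negative.\<close>

definition gain :: "'p set \<Rightarrow> nat \<Rightarrow> (nat \<Rightarrow> 'p set) \<Rightarrow> nat set \<Rightarrow> nat \<Rightarrow> int" where
  "gain P K H W u =
     int (g P K H (clients K - (W \<union> {u}))) - int (g P K H (clients K - {u}))"

definition subset_bound :: "'p set \<Rightarrow> nat \<Rightarrow> (nat \<Rightarrow> 'p set) \<Rightarrow> nat set \<Rightarrow> int" where
  "subset_bound P K H W =
     \<lceil>(real (g P K H (clients K - W)) + (\<Sum>j\<in>clients K - W. real (g P K H (clients K - {j}))))
        / real (card (clients K - W))\<rceil>"

text \<open>The algorithm may pick any maximizer, so it is a relation. \<open>inner_loop P K H k \<beta>\<^sub>0 m W \<beta>\<close>: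
  when the loop for client \<open>k\<close> is entered with value \<open>\<beta>\<^sub>0\<close>, then some sequence of choices leads
  after iteration \<open>m\<close> to \<open>W\<^sub>m = W\<close> and current value \<open>\<beta>\<close>; the index \<open>m = 1\<close> is the state
  before the first iteration.\<close>

inductive inner_loop ::
    "'p set \<Rightarrow> nat \<Rightarrow> (nat \<Rightarrow> 'p set) \<Rightarrow> nat \<Rightarrow> int \<Rightarrow> nat \<Rightarrow> nat set \<Rightarrow> int \<Rightarrow> bool"
  for P K H k \<beta>\<^sub>0 where
  start: "inner_loop P K H k \<beta>\<^sub>0 1 {k} \<beta>\<^sub>0"
| iterate: "inner_loop P K H k \<beta>\<^sub>0 (Suc m) (W \<union> {u}) (max \<beta> (subset_bound P K H (W \<union> {u})))"
    if "inner_loop P K H k \<beta>\<^sub>0 m W \<beta>" and "Suc m \<in> {2..K - 1}"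
      and "is_arg_max (gain P K H W) (\<lambda>u. u \<in> clients K - W) u"

text \<open>\<open>outer_loop P K H k \<beta>\<close>: \<open>\<beta>\<close> is a possible current value after the clients \<open>1, \<dots>, k\<close>
  have been processed.\<close>

inductive outer_loop :: "'p set \<Rightarrow> nat \<Rightarrow> (nat \<Rightarrow> 'p set) \<Rightarrow> nat \<Rightarrow> int \<Rightarrow> bool"
  for P K H where
  start: "outer_loop P K H 0 (initial_bound P K H)"
| iterate: "outer_loop P K H (Suc k) \<beta>'"
    if "outer_loop P K H k \<beta>" and "Suc k \<in> clients K"
      and "inner_loop P K H (Suc k) \<beta> (K - 1) W \<beta>'"

definition algorithm_output :: "'p set \<Rightarrow> nat \<Rightarrow> (nat \<Rightarrow> 'p set) \<Rightarrow> int \<Rightarrow> bool" where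
  "algorithm_output P K H \<beta> \<longleftrightarrow> outer_loop P K H K \<beta>"

text \<open>The minimum sum-rate is attained, and the algorithm never gets stuck.\<close>

lemma rate_region_nonempty:
  assumes "cde_system P K H"
  shows "\<exists>\<alpha>. rate_region P K H \<alpha> \<noteq> {}"
proof -
  have fin: "finite P" and K: "2 \<le> K" and un: "(\<Union>j\<in>clients K. H j) = P"
    using assms by (auto simp: cde_system_def)
  define r :: "nat \<Rightarrow> nat" where "r = restrict (\<lambda>_. card P) (clients K)"
  have "g P K H X \<le> sum r X" if X: "X \<subset> clients K" for X
  proof (cases "X = {}")
    case True
    have "1 \<in> clients K" using K by simp
    then have "(\<Inter>j\<in>clients K. P - H j) = {}" using un by blast
    then have "g P K H X = 0" using True by (simp add: g_def)
    then show ?thesis by simp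
  next
    case False
    then obtain x where x: "x \<in> X" by blast
    obtain j where "j \<in> clients K - X" using X by blast
    then have "(\<Inter>j\<in>clients K - X. P - H j) \<subseteq> P" by blast
    then have "g P K H X \<le> card P" unfolding g_def using fin by (rule card_mono[rotated])
    also have "\<dots> = r x" using x X by (auto simp: r_def)
    also have "r x \<le> sum r X" using x finite_subset[of X "clients K"] X by (intro member_le_sum) auto
    finally show ?thesis .
  qed
  then have "r \<in> rate_region P K H (sum r (clients K))"
    by (auto simp: rate_region_def r_def)
  then show ?thesis by blast
qed

lemma inner_loop_total:
  assumes "k \<in> clients K" "m \<in> {1..K - 1}"
  shows "\<exists>W \<beta>. inner_loop P K H k \<beta>\<^sub>0 m W \<beta> \<and> W \<subseteq> clients K \<and> card W = m"
  using assms(2)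
proof (induction m)
  case (Suc m)
  show ?case
  proof (cases "m = 0")
    case True
    then show ?thesis using assms(1) inner_loop.start[of P K H k \<beta>\<^sub>0] by auto
  next
    case False
    then obtain W \<beta> where W: "inner_loop P K H k \<beta>\<^sub>0 m W \<beta>" "W \<subseteq> clients K" "card W = m"
      using Suc by auto
    have fin: "finite W" using W(2) finite_subset by blast
    have "W \<noteq> clients K" using W(3) Suc.prems by auto
    then have ne: "clients K - W \<noteq> {}" using W(2) by blast
    let ?G = "gain P K H W ` (clients K - W)"
    have "Max ?G \<in> ?G" using ne by (intro Max_in) auto
    then obtain u where u: "u \<in> clients K - W" "gain P K H W u = Max ?G" by auto
    have "gain P K H W v \<le> gain P K H W u" if "v \<in> clients K - W" for v
      unfolding u(2) using that by (intro Max_ge) auto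
    then have "is_arg_max (gain P K H W) (\<lambda>u. u \<in> clients K - W) u"
      unfolding is_arg_max_def using u(1) not_less by blast
    from inner_loop.iterate[OF W(1) _ this] False Suc.prems
    have "inner_loop P K H k \<beta>\<^sub>0 (Suc m) (W \<union> {u}) (max \<beta> (subset_bound P K H (W \<union> {u})))"
      by auto
    moreover have "W \<union> {u} \<subseteq> clients K" "card (W \<union> {u}) = Suc m"
      using u W fin by auto
    ultimately show ?thesis by blast
  qed
qed simp

lemma algorithm_output_exists:
  assumes "cde_system P K H"
  shows "\<exists>\<beta>. algorithm_output P K H \<beta>"
proof -
  have K: "2 \<le> K" using assms by (simp add: cde_system_def)
  have "\<exists>\<beta>. outer_loop P K H k \<beta>" if "k \<le> K" for k
    using that
  proof (induction k)
    case 0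
    then show ?case using outer_loop.start by blast
  next
    case (Suc k)
    then obtain \<beta> where \<beta>: "outer_loop P K H k \<beta>" by auto
    have k: "Suc k \<in> clients K" using Suc.prems by simp
    have "K - 1 \<in> {1..K - 1}" using K by simp
    from inner_loop_total[OF k this] obtain W \<beta>'
      where "inner_loop P K H (Suc k) \<beta> (K - 1) W \<beta>'" by blast
    then show ?case using outer_loop.iterate[OF \<beta> k] by blast
  qed
  then show ?thesis by (auto simp: algorithm_output_def)
qed

end

theory Submission
  imports Defs
begin

text \<open>Every bound the algorithm forms is valid for every feasible rate vector, whichever clients are
  chosen: if \<open>r\<close> is feasible with sum-rate \<open>\<alpha>\<close>, the constraint for the complement of \<open>{j}\<close> reads
  \<open>r j + g (clients K - {j}) \<le> \<alpha>\<close>, and summing it over a set \<open>T\<close> of clients leaves the term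
  \<open>sum r T\<close>, which is \<open>\<alpha>\<close> if \<open>T\<close> is everything and at least \<open>g T\<close> if \<open>T\<close> is proper.\<close>

lemma rate_regionD:
  assumes "r \<in> rate_region P K H \<alpha>"
  shows "X \<subset> clients K \<Longrightarrow> g P K H X \<le> sum r X" and "sum r (clients K) = \<alpha>"
  using assms unfolding rate_region_def by blast+

lemma sum_singleton_complements_le:
  assumes r: "r \<in> rate_region P K H \<alpha>" and T: "T \<subseteq> clients K"
  shows "sum r T + (\<Sum>j\<in>T. g P K H (clients K - {j})) \<le> card T * \<alpha>"
proof -
  have "r j + g P K H (clients K - {j}) \<le> \<alpha>" if "j \<in> T" for j
  proof -
    have j: "j \<in> clients K" using that T by blast
    then have "g P K H (clients K - {j}) \<le> sum r (clients K - {j})"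
      by (intro rate_regionD(1)[OF r]) blast
    moreover have "r j + sum r (clients K - {j}) = \<alpha>"
      using sum.remove[OF finite_atLeastAtMost j, of r] rate_regionD(2)[OF r] by linarith
    ultimately show ?thesis by linarith
  qed
  then have "(\<Sum>j\<in>T. r j + g P K H (clients K - {j})) \<le> card T * \<alpha>"
    using sum_bounded_above[of T _ \<alpha>] by simp
  then show ?thesis by (simp add: sum.distrib)
qed

lemma initial_bound_le:
  assumes r: "r \<in> rate_region P K H \<alpha>" and K: "2 \<le> K"
  shows "initial_bound P K H \<le> int \<alpha>"
proof -
  let ?S = "\<Sum>j\<in>clients K. g P K H (clients K - {j})"
  have "\<alpha> + ?S \<le> K * \<alpha>"
    using sum_singleton_complements_le[OF r order_refl] rate_regionD(2)[OF r] by simp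
  then have "real \<alpha> + real ?S \<le> real K * real \<alpha>"
    by (simp only: of_nat_le_iff flip: of_nat_add of_nat_mult)
  \<comment> \<open>One of the \<open>K\<close> copies of \<alpha> cancels, and
    \<open>2 \<le> K\<close> makes the remaining factor positive.\<close>
  then have "real ?S / (real K - 1) \<le> real \<alpha>"
    using K by (simp add: field_simps)
  \<comment> \<open>Since \<alpha> is an integer, bounding the ceiling amounts to bounding the real
    quotient.\<close>
  then show ?thesis
    by (simp add: initial_bound_def ceiling_le_iff flip: sum_divide_distrib)
qed

lemma subset_bound_le:
  assumes r: "r \<in> rate_region P K H \<alpha>" and W: "W \<inter> clients K \<noteq> {}"
  shows "subset_bound P K H W \<le> int \<alpha>"
proof -
  let ?T = "clients K - W"
  let ?S = "\<Sum>j\<in>?T. g P K H (clients K - {j})"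
  have "?T \<subset> clients K" using W by blast
  then have "g P K H ?T \<le> sum r ?T" by (rule rate_regionD(1)[OF r])
  then have "g P K H ?T + ?S \<le> card ?T * \<alpha>"
    using sum_singleton_complements_le[OF r Diff_subset, of W] by linarith
  then have le: "real (g P K H ?T) + real ?S \<le> real (card ?T) * real \<alpha>"
    by (simp only: of_nat_le_iff flip: of_nat_add of_nat_mult)
  have "(real (g P K H ?T) + real ?S) / real (card ?T) \<le> real \<alpha>"
  \<comment> \<open>If \<open>W\<close> covers all clients, the quotient is 0 by the convention for
    division by zero. Admitting this case spares tracking the size of \<open>W\<close> through the
    loop.\<close>
  proof (cases "card ?T = 0")
    case True
    then show ?thesis by (simp only: of_nat_0 div_by_0 of_nat_0_le_iff)
  next
    case False
    then have "0 < real (card ?T)" by (simp only: of_nat_0_less_iff neq0_conv)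
    then show ?thesis using le by (simp only: pos_divide_le_eq mult.commute)
  qed
  then show ?thesis by (simp add: subset_bound_def ceiling_le_iff)
qed

text \<open>The invariant \<open>k \<in> W\<close> keeps the complement of \<open>W\<close> a proper
  subset of the clients, as \<open>subset_bound_le\<close> requires.\<close>

lemma inner_loop_le:
  assumes "inner_loop P K H k \<beta>\<^sub>0 m W \<beta>" and r: "r \<in> rate_region P K H \<alpha>"
    and k: "k \<in> clients K" and \<beta>\<^sub>0: "\<beta>\<^sub>0 \<le> int \<alpha>"
  shows "k \<in> W \<and> \<beta> \<le> int \<alpha>"
  using assms(1)
proof induction
  case start
  then show ?case using \<beta>\<^sub>0 by simp
next
  case (iterate m W \<beta> u)
  then have "(W \<union> {u}) \<inter> clients K \<noteq> {}" using k by blast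
  from subset_bound_le[OF r this] show ?case using iterate.IH by simp
qed

lemma outer_loop_le:
  assumes "outer_loop P K H k \<beta>" and r: "r \<in> rate_region P K H \<alpha>" and K: "2 \<le> K"
  shows "\<beta> \<le> int \<alpha>"
  using assms(1)
proof induction
  case start
  then show ?case by (rule initial_bound_le[OF r K])
next
  case (iterate k \<beta> W \<beta>')
  \<comment> \<open>The induction hypothesis bounds the value with which the next client's loop is
    entered.\<close>
  then show ?case using inner_loop_le[OF _ r] by blast
qed

theorem mainTheorem3:
  fixes P :: "'p set" and K :: nat and H :: "nat \<Rightarrow> 'p set" and \<beta> :: int
  assumes "cde_system P K H"
    and "algorithm_output P K H \<beta>"
  shows "\<beta> \<le> int (min_sum_rate P K H)"
proof -
  \<comment> \<open>Some sum-rate is feasible, so the least one is attained by a rate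
    vector.\<close>
  have "rate_region P K H (min_sum_rate P K H) \<noteq> {}"
    unfolding min_sum_rate_def using rate_region_nonempty[OF assms(1)] by (rule LeastI_ex)
  then obtain r where "r \<in> rate_region P K H (min_sum_rate P K H)" by blast
  then show ?thesis
    using assms outer_loop_le by (auto simp: algorithm_output_def cde_system_def)
qed

end
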